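(* Let $N\ge2$, let $-1=x_0<x_1<\cdots<x_N=1$, and let $\mathcal S=\{s_1,\ldots,s_N\}$ be a family of intervals $s_i=[x_{\ell_i},x_{r_i}]$ with integers $0\le\ell_i<r_i\le N$ whose endpoint graph $\mathcal G_{\mathcal S}$ is connected. Let $\alpha,\beta>-1$, $\zeta\in\{-1,1\}$, and $W_N=\operatorname{diag}(w_1,\ldots,w_N)$ with $w_i>0$ for all $i$. Then there is a unique family of monic polynomials $\Phi_0,\ldots,\Phi_{N-1}$ with $\deg(\Phi_k)=k$ that is orthogonal for the form $[\cdot,\cdot]_{\mathcal S,W_N}^{(\zeta)}$, i.e. $$[\Phi_j,\Phi_k]_{\mathcal S,W_N}^{(\zeta)}=h_k\delta_{jk},\quad h_k>0,\quad j,k=0,\ldots,N-1.$$ Equivalently, the matrix $M\in\mathbb R^{N\times N}$ with entries $[M]_{i,k+1}=\int_{s_i}\Phi_k(x)\omega_{\alpha,\beta}^{(\zeta)}(x)\,dx$, $i=1,\ldots,N$, $k=0,\ldots,N-1$, satisfies $$M^\top W_NM=\operatorname{diag}(h_0,\ldots,h_{N-1}),\quad h_k>0.$$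
   Context: The endpoint graph $\mathcal G_{\mathcal S}$ is the undirected graph with vertex set $\{0,\ldots,N\}$ and edge set $\{\{\ell_i,r_i\}:i=1,\ldots,N\}$. The weight is $\omega_{\alpha,\beta}^{(\zeta)}(x)=(1-\zeta x)(1-x)^\alpha(1+x)^\beta$ on $(-1,1)$. For a real polynomial $p$ of degree at most $N-1$ the moment vector is $\boldsymbol m_{\mathcal S}^{(\zeta)}(p)=\left(\int_{s_1}p\,\omega_{\alpha,\beta}^{(\zeta)}dx,\ldots,\int_{s_N}p\,\omega_{\alpha,\beta}^{(\zeta)}dx\right)^\top$, and $[p,q]_{\mathcal S,W_N}^{(\zeta)}=\left(\boldsymbol m_{\mathcal S}^{(\zeta)}(p)\right)^\top W_N\,\boldsymbol m_{\mathcal S}^{(\zeta)}(q)$. *)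

theory Defs
  imports "HOL-Analysis.Analysis" "Jordan_Normal_Form.Matrix"
begin

hide_const (open) Finite_Cartesian_Product.vec

definition endpoint_edges :: "nat \<Rightarrow> (nat \<Rightarrow> nat) \<Rightarrow> (nat \<Rightarrow> nat) \<Rightarrow> nat set set" where
  "endpoint_edges N l r = {{l i, r i} |i. i \<in> {1..N}}"

definition graph_connected :: "'a set \<Rightarrow> 'a set set \<Rightarrow> bool" where
  "graph_connected V E \<longleftrightarrow>
     (\<forall>u\<in>V. \<forall>v\<in>V. (u, v) \<in> {(a, b). a \<in> V \<and> b \<in> V \<and> {a, b} \<in> E}\<^sup>*)"

text \<open>The weight is only meant on the open interval \<open>(-1, 1)\<close>; at the endpoints the convention
  \<open>0 powr a = 0\<close> applies, which affects no integral.\<close>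
definition jacobi_weight :: "real \<Rightarrow> real \<Rightarrow> real \<Rightarrow> real \<Rightarrow> real" where
  "jacobi_weight \<alpha> \<beta> \<zeta> x = (1 - \<zeta> * x) * (1 - x) powr \<alpha> * (1 + x) powr \<beta>"

definition moment :: "real \<Rightarrow> real \<Rightarrow> real \<Rightarrow> real set \<Rightarrow> real poly \<Rightarrow> real" where
  "moment \<alpha> \<beta> \<zeta> A p = (LINT x:A|lborel. poly p x * jacobi_weight \<alpha> \<beta> \<zeta> x)"

text \<open>The intervals are numbered \<open>s 1, \<dots>, s N\<close>, whereas vectors and matrices are indexed from
  \<open>0\<close>, hence \<open>Suc i\<close> here and in the matrices below.\<close>
definition moment_vec ::
  "nat \<Rightarrow> real \<Rightarrow> real \<Rightarrow> real \<Rightarrow> (nat \<Rightarrow> real set) \<Rightarrow> real poly \<Rightarrow> real vec" where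
  "moment_vec N \<alpha> \<beta> \<zeta> s p = vec N (\<lambda>i. moment \<alpha> \<beta> \<zeta> (s (Suc i)) p)"

definition moment_form ::
  "nat \<Rightarrow> real \<Rightarrow> real \<Rightarrow> real \<Rightarrow> (nat \<Rightarrow> real set) \<Rightarrow> real mat \<Rightarrow>
     real poly \<Rightarrow> real poly \<Rightarrow> real" where
  "moment_form N \<alpha> \<beta> \<zeta> s W p q =
     scalar_prod (moment_vec N \<alpha> \<beta> \<zeta> s p) (W *\<^sub>v moment_vec N \<alpha> \<beta> \<zeta> s q)"

definition moment_matrix ::
  "nat \<Rightarrow> real \<Rightarrow> real \<Rightarrow> real \<Rightarrow> (nat \<Rightarrow> real set) \<Rightarrow> (nat \<Rightarrow> real poly) \<Rightarrow> real mat" where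
  "moment_matrix N \<alpha> \<beta> \<zeta> s \<Phi> =
     mat N N (\<lambda>(i, k). moment \<alpha> \<beta> \<zeta> (s (Suc i)) (\<Phi> k))"

text \<open>A family \<open>\<Phi> 0, \<dots>, \<Phi> (N - 1)\<close> is a function on \<open>{..<N}\<close>; extensionality fixes the
  irrelevant values, so that uniqueness of the family is equality of functions.\<close>
definition monic_families :: "nat \<Rightarrow> (nat \<Rightarrow> real poly) set" where
  "monic_families N = (\<Pi>\<^sub>E k\<in>{..<N}. {p. lead_coeff p = 1 \<and> degree p = k})"

definition orthogonal_family ::
  "nat \<Rightarrow> (real poly \<Rightarrow> real poly \<Rightarrow> real) \<Rightarrow> (nat \<Rightarrow> real poly) \<Rightarrow> (nat \<Rightarrow> real) \<Rightarrow> bool" where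
  "orthogonal_family N B \<Phi> h \<longleftrightarrow>
     (\<forall>j<N. \<forall>k<N. B (\<Phi> j) (\<Phi> k) = (if j = k then h k else 0)) \<and> (\<forall>k<N. h k > 0)"

end

theory Submission imports Defs begin

text \<open>
  The form is the pull-back of a positive definite diagonal form along the moment map
  \<open>p \<mapsto> (\<integral>\<^bsub>s 1\<^esub> p \<omega>, \<dots>, \<integral>\<^bsub>s N\<^esub> p \<omega>)\<close>. So everything rests on this map being injective on the
  polynomials of degree less than \<open>N\<close>: then the form is positive definite there, and the
  Gram--Schmidt process yields the monic orthogonal family and its uniqueness.

  For injectivity (\<open>zero_if_moments_zero\<close>), consider \<open>F j = \<integral> p \<omega>\<close> over \<open>[x 0, x j]\<close>. The moment over
  \<open>s i\<close> is \<open>F (r i) - F (l i)\<close>, so if all moments vanish, then \<open>F\<close> takes equal values at the two ends of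
  every edge of the endpoint graph, and connectedness makes \<open>F\<close> constant. Hence \<open>p \<omega>\<close> integrates to
  zero over each of the \<open>N\<close> gaps \<open>[x j, x (j + 1)]\<close>. As \<open>\<omega>\<close> is positive inside, \<open>p\<close> has a zero in
  the interior of each gap, that is, \<open>N\<close> distinct zeros, which forces \<open>p = 0\<close> if the degree is
  less than \<open>N\<close>.
\<close>

section \<open>Orthogonalisation for a form that is positive in low degrees\<close>

text \<open>Stating the degree bound through coefficients makes these sets linear subspaces without a
  separate treatment of the zero polynomial, also for \<open>k = 0\<close>.\<close>
definition polys_below :: "nat \<Rightarrow> real poly set" where
  "polys_below k = {q. \<forall>m\<ge>k. coeff q m = 0}"

lemma polys_below_iff: "q \<in> polys_below k \<longleftrightarrow> q = 0 \<or> degree q < k"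
proof
  assume "q \<in> polys_below k"
  then have "coeff q (degree q) = 0" if "k \<le> degree q"
    using that by (simp add: polys_below_def)
  then show "q = 0 \<or> degree q < k" by force
next
  assume "q = 0 \<or> degree q < k"
  then show "q \<in> polys_below k"
    unfolding polys_below_def by (auto intro: coeff_eq_0)
qed

lemma monic_diff_in_polys_below:
  assumes "degree p = k" "lead_coeff p = 1" "degree q = k" "lead_coeff q = (1::real)"
  shows "p - q \<in> polys_below k"
  unfolding polys_below_def
proof (intro CollectI allI impI)
  fix m assume "k \<le> m"
  then show "coeff (p - q) m = 0"
    using assms by (cases "m = k") (auto simp: coeff_eq_0)
qed

lemma monic_familiesD:
  assumes "\<Phi> \<in> monic_families N" "k < N"
  shows "degree (\<Phi> k) = k" "lead_coeff (\<Phi> k) = 1"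
  using assms unfolding monic_families_def by (auto dest!: PiE_mem)

locale positive_poly_form =
  fixes B :: "real poly \<Rightarrow> real poly \<Rightarrow> real" and N :: nat
  assumes sym: "B p q = B q p"
    and add: "B (p + q) u = B p u + B q u"
    and smult: "B (Polynomial.smult c p) u = c * B p u"
    and pos: "p \<noteq> 0 \<Longrightarrow> degree p < N \<Longrightarrow> 0 < B p p"
begin

lemma zero: "B 0 u = 0"
  using smult[of 0 0 u] by simp

lemma diff: "B (p - q) u = B p u - B q u"
  using add[of "p - q" q u] by simp

lemma sum: "B (\<Sum>j<(k::nat). f j) u = (\<Sum>j<k. B (f j) u)"
  by (induction k) (auto simp: zero add)

text \<open>Monic polynomials of all degrees less than \<open>k\<close> span the polynomials of degree less than \<open>k\<close>,
  so orthogonality need only be tested on them.\<close>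
lemma orthogonal_to_polys_below:
  assumes "\<And>j. j < k \<Longrightarrow> degree (\<Phi> j) = j \<and> lead_coeff (\<Phi> j) = 1"
    and "\<And>j. j < k \<Longrightarrow> B (\<Phi> j) u = 0" and "q \<in> polys_below k"
  shows "B q u = 0"
  using assms
proof (induction k arbitrary: q)
  case 0
  then have "q = 0" by (simp add: polys_below_iff)
  then show ?case by (simp add: zero)
next
  case (Suc k)
  let ?q = "q - Polynomial.smult (coeff q k) (\<Phi> k)"
  have \<Phi>: "degree (\<Phi> k) = k" "coeff (\<Phi> k) k = 1" using Suc.prems(1)[of k] by auto
  have "?q \<in> polys_below k"
    unfolding polys_below_def
  proof (intro CollectI allI impI)
    fix m assume "k \<le> m"
    then show "coeff ?q m = 0"
      using \<Phi> Suc.prems(3) by (cases "m = k") (auto simp: polys_below_def coeff_eq_0)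
  qed
  then have "B ?q u = 0"
    using Suc.IH[of ?q] Suc.prems(1,2)[OF less_SucI] by blast
  then show ?case using Suc.prems(2)[of k] by (simp add: diff smult)
qed

lemma ex_monic_orthogonal:
  "k < N \<Longrightarrow> \<exists>p. degree p = k \<and> lead_coeff p = 1 \<and> (\<forall>q\<in>polys_below k. B q p = 0)"
proof (induction k rule: less_induct)
  case (less k)
  then have "\<forall>j\<in>{..<k}. \<exists>p. degree p = j \<and> lead_coeff p = 1 \<and> (\<forall>q\<in>polys_below j. B q p = 0)"
    by auto
  then obtain \<Phi> where \<Phi>: "\<And>j. j < k \<Longrightarrow> degree (\<Phi> j) = j \<and> lead_coeff (\<Phi> j) = 1"
    and orth: "\<And>j q. j < k \<Longrightarrow> q \<in> polys_below j \<Longrightarrow> B q (\<Phi> j) = 0"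
    unfolding bchoice_iff by auto
  have orth': "B (\<Phi> i) (\<Phi> j) = 0" if "i < k" "j < k" "i \<noteq> j" for i j
  proof (cases "i < j")
    case True
    then show ?thesis using that \<Phi> orth by (auto simp: polys_below_iff)
  next
    case False
    then have "\<Phi> j \<in> polys_below i" using that \<Phi> by (auto simp: polys_below_iff)
    then show ?thesis using orth[of i "\<Phi> j"] that sym by simp
  qed
  have norm: "B (\<Phi> j) (\<Phi> j) > 0" if "j < k" for j
    using \<Phi>[OF that] less.prems that by (intro pos) auto
  \<comment> \<open>Gram--Schmidt: subtract from the power of degree \<open>k\<close> its projections onto the lower members.\<close>
  define c where "c j = B (monom 1 k) (\<Phi> j) / B (\<Phi> j) (\<Phi> j)" for j
  define p where "p = monom 1 k - (\<Sum>j<k. Polynomial.smult (c j) (\<Phi> j))"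
  have coeffs: "coeff p m = (if m = k then 1 else 0)" if "k \<le> m" for m
    using that \<Phi> by (auto simp: p_def coeff_sum coeff_eq_0 intro!: sum.neutral)
  have deg: "degree p = k"
    by (rule antisym) (auto intro!: degree_le le_degree simp: coeffs)
  have "B (\<Phi> i) p = 0" if "i < k" for i
  proof -
    have "(\<Sum>j<k. c j * B (\<Phi> j) (\<Phi> i)) = (\<Sum>j<k. if j = i then c i * B (\<Phi> i) (\<Phi> i) else 0)"
      using orth' that by (intro sum.cong) auto
    also have "\<dots> = B (monom 1 k) (\<Phi> i)" using that norm[OF that] by (simp add: c_def)
    finally have "B p (\<Phi> i) = 0" by (simp add: p_def diff sum smult)
    then show ?thesis by (simp add: sym)
  qed
  then have "\<forall>q\<in>polys_below k. B q p = 0" using \<Phi> orthogonal_to_polys_below by blast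
  then show ?case using deg coeffs by (intro exI[of _ p]) simp
qed

text \<open>Two candidates differ by a polynomial of degree less than \<open>k\<close>, which is then orthogonal to
  itself.\<close>
lemma monic_orthogonal_unique:
  assumes "k < N"
    and p: "degree p = k" "lead_coeff p = 1" "\<And>q. q \<in> polys_below k \<Longrightarrow> B q p = 0"
    and p': "degree p' = k" "lead_coeff p' = 1" "\<And>q. q \<in> polys_below k \<Longrightarrow> B q p' = 0"
  shows "p = p'"
proof (rule ccontr)
  assume "p \<noteq> p'"
  have D: "p - p' \<in> polys_below k" using p p' by (intro monic_diff_in_polys_below)
  have "B (p - p') (p - p') = B (p - p') p - B (p - p') p'"
    by (metis diff sym)
  also have "\<dots> = 0" using p(3) p'(3) D by simp
  finally show False
    using pos[of "p - p'"] D \<open>p \<noteq> p'\<close> \<open>k < N\<close> by (auto simp: polys_below_iff)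
qed

lemma orthogonal_family_imp_orthogonal_below:
  assumes "\<Phi> \<in> monic_families N" "orthogonal_family N B \<Phi> h" "k < N" "q \<in> polys_below k"
  shows "B q (\<Phi> k) = 0"
proof (rule orthogonal_to_polys_below[OF _ _ assms(4)])
  fix j assume j: "j < k"
  then show "degree (\<Phi> j) = j \<and> lead_coeff (\<Phi> j) = 1"
    using monic_familiesD[OF assms(1), of j] \<open>k < N\<close> by linarith
  show "B (\<Phi> j) (\<Phi> k) = 0"
    using assms(2,3) j unfolding orthogonal_family_def by simp
qed

theorem ex1_monic_orthogonal_family:
  "\<exists>!\<Phi>. \<Phi> \<in> monic_families N \<and> (\<exists>h. orthogonal_family N B \<Phi> h)"
proof (rule ex_ex1I)
  have "\<forall>k\<in>{..<N}. \<exists>p. degree p = k \<and> lead_coeff p = 1 \<and> (\<forall>q\<in>polys_below k. B q p = 0)"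
    using ex_monic_orthogonal by auto
  then obtain \<Phi> where \<Phi>: "\<And>k. k < N \<Longrightarrow> degree (\<Phi> k) = k \<and> lead_coeff (\<Phi> k) = 1"
    and orth: "\<And>k q. k < N \<Longrightarrow> q \<in> polys_below k \<Longrightarrow> B q (\<Phi> k) = 0"
    unfolding bchoice_iff by auto
  let ?\<Phi> = "restrict \<Phi> {..<N}"
  have mem: "?\<Phi> \<in> monic_families N" using \<Phi> by (auto simp: monic_families_def)
  have lt: "B (\<Phi> j) (\<Phi> k) = 0" if "j < k" "k < N" for j k
    using that \<Phi> orth by (auto simp: polys_below_iff)
  have "B (\<Phi> j) (\<Phi> k) = 0" if "j < N" "k < N" "j \<noteq> k" for j k
    using that lt sym by (metis linorder_neqE_nat)
  moreover have "B (\<Phi> k) (\<Phi> k) > 0" if "k < N" for k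
    using \<Phi>[OF that] that by (intro pos) auto
  ultimately have "orthogonal_family N B ?\<Phi> (\<lambda>k. B (\<Phi> k) (\<Phi> k))"
    by (auto simp: orthogonal_family_def)
  with mem show "\<exists>\<Phi>. \<Phi> \<in> monic_families N \<and> (\<exists>h. orthogonal_family N B \<Phi> h)" by blast
next
  fix \<Phi> \<Psi>
  assume "\<Phi> \<in> monic_families N \<and> (\<exists>h. orthogonal_family N B \<Phi> h)"
    and "\<Psi> \<in> monic_families N \<and> (\<exists>h. orthogonal_family N B \<Psi> h)"
  then obtain h h' where *: "\<Phi> \<in> monic_families N" "orthogonal_family N B \<Phi> h"
    "\<Psi> \<in> monic_families N" "orthogonal_family N B \<Psi> h'" by blast
  show "\<Phi> = \<Psi>"
  proof (rule PiE_ext[OF *(1,3)[unfolded monic_families_def]])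
    fix k assume "k \<in> {..<N}"
    then have k: "k < N" by simp
    show "\<Phi> k = \<Psi> k"
      using k monic_familiesD[OF *(1) k] orthogonal_family_imp_orthogonal_below[OF *(1,2) k]
        monic_familiesD[OF *(3) k] orthogonal_family_imp_orthogonal_below[OF *(3,4) k]
      by (rule monic_orthogonal_unique)
  qed
qed

end

section \<open>Linearity of the moments\<close>

text \<open>An affine substitution turns the weight into the integrand of the Beta function on \<open>[0, 1]\<close>.\<close>
lemma jacobi_integrable:
  assumes "\<alpha> > -1" "\<beta> > -1"
  shows "set_integrable lborel {-1..1} (\<lambda>t::real. (1 - t) powr \<alpha> * (1 + t) powr \<beta>)"
proof -
  let ?b = "\<lambda>t::real. t powr \<beta> * (1 - t) powr \<alpha>"
  let ?f = "\<lambda>t::real. (1 - t) powr \<alpha> * (1 + t) powr \<beta>"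
  have "(?b has_integral Beta (\<beta> + 1) (\<alpha> + 1)) (cbox 0 1)"
    using has_integral_Beta_real[of "\<beta> + 1" "\<alpha> + 1"] assms by simp
  from has_integral_affinity'[OF this, of "1/2" "1/2"]
  have "(\<lambda>t. ?b (t / 2 + 1 / 2)) integrable_on {-1..1}"
    by (auto simp: integrable_on_def)
  then have "(\<lambda>t. 2 powr (\<alpha> + \<beta>) * ?b (t / 2 + 1 / 2)) integrable_on {-1..1}"
    by (rule integrable_on_mult_right)
  moreover have "2 powr (\<alpha> + \<beta>) * ?b (t / 2 + 1 / 2) = ?f t" if "t \<in> {-1..1}" for t
  proof -
    have eq: "t / 2 + 1 / 2 = (1 + t) / 2" "1 - (1 + t) / 2 = (1 - t) / 2"
      by (simp_all add: field_simps)
    have "((1 + t) / 2) powr \<beta> = (1 + t) powr \<beta> / 2 powr \<beta>"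
      "((1 - t) / 2) powr \<alpha> = (1 - t) powr \<alpha> / 2 powr \<alpha>"
      using that by (simp_all add: powr_divide)
    then show ?thesis unfolding eq powr_add by simp
  qed
  ultimately have "?f integrable_on {-1..1}" by (metis (no_types, lifting) integrable_cong)
  then have "?f absolutely_integrable_on {-1..1}"
    by (rule nonnegative_absolutely_integrable_1) auto
  then show ?thesis
    unfolding set_integrable_def by (subst (asm) integrable_completion) auto
qed

text \<open>The remaining factor is continuous on the compact interval, hence bounded there. Integrability
  is what makes the moments additive, the Bochner integral being \<open>0\<close> by default otherwise.\<close>
lemma jacobi_weight_integrable:
  assumes "\<alpha> > -1" "\<beta> > -1" "A \<in> sets lborel" "A \<subseteq> {-1..1}"
  shows "set_integrable lborel A (\<lambda>t. poly p t * jacobi_weight \<alpha> \<beta> \<zeta> t)"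
proof (rule set_integrable_subset[OF _ assms(3,4)])
  let ?g = "\<lambda>t::real. poly p t * (1 - \<zeta> * t)"
  let ?f = "\<lambda>t::real. (1 - t) powr \<alpha> * (1 + t) powr \<beta>"
  have "compact (?g ` {-1..1})"
    by (intro compact_continuous_image continuous_intros) auto
  then obtain K where "\<forall>y\<in>?g ` {-1..1}. \<bar>y\<bar> \<le> K"
    by (auto dest!: compact_imp_bounded simp only: bounded_real)
  then have K: "\<bar>?g t\<bar> \<le> K" if "t \<in> {-1..1}" for t
    using that by blast
  have "set_integrable lborel {-1..1} (\<lambda>t. K * ?f t)"
    using jacobi_integrable[OF assms(1,2)] by (intro set_integrable_mult_right)
  moreover have [measurable]: "poly p \<in> borel_measurable borel"
    by (intro borel_measurable_continuous_onI continuous_intros)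
  have "set_borel_measurable lborel {-1..1} (\<lambda>t. ?g t * ?f t)"
    unfolding set_borel_measurable_def
    by measurable
  moreover have "AE t in lborel. t \<in> {-1..1} \<longrightarrow> norm (?g t * ?f t) \<le> norm (K * ?f t)"
  proof (intro AE_I2 impI)
    fix t :: real assume "t \<in> {-1..1}"
    then have "\<bar>?g t\<bar> * ?f t \<le> \<bar>K\<bar> * ?f t"
      using K[of t] by (intro mult_right_mono) auto
    then show "norm (?g t * ?f t) \<le> norm (K * ?f t)" by (simp add: abs_mult)
  qed
  ultimately have "set_integrable lborel {-1..1} (\<lambda>t. ?g t * ?f t)"
    by (rule set_integrable_bound)
  then show "set_integrable lborel {-1..1} (\<lambda>t. poly p t * jacobi_weight \<alpha> \<beta> \<zeta> t)"
    by (simp add: jacobi_weight_def mult.assoc)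
qed

lemma jacobi_weight_pos:
  assumes "\<zeta> \<in> {-1, 1}" "t \<in> {-1<..<1}"
  shows "jacobi_weight \<alpha> \<beta> \<zeta> t > 0"
  using assms by (auto simp: jacobi_weight_def)

lemma moment_add:
  assumes "\<alpha> > -1" "\<beta> > -1" "A \<in> sets lborel" "A \<subseteq> {-1..1}"
  shows "moment \<alpha> \<beta> \<zeta> A (p + q) = moment \<alpha> \<beta> \<zeta> A p + moment \<alpha> \<beta> \<zeta> A q"
  using set_integral_add(2)[OF jacobi_weight_integrable[OF assms, of p \<zeta>]
      jacobi_weight_integrable[OF assms, of q \<zeta>]]
  by (simp add: moment_def distrib_right)

lemma moment_smult: "moment \<alpha> \<beta> \<zeta> A (Polynomial.smult c p) = c * moment \<alpha> \<beta> \<zeta> A p"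
  by (simp add: moment_def mult.assoc)

section \<open>Injectivity of the moment map\<close>

text \<open>This is the only use of the endpoint graph: the equality is passed on along a path.\<close>
lemma constant_if_equal_on_edges:
  assumes "graph_connected V (endpoint_edges N l r)"
    and "\<And>i. i \<in> {1..N} \<Longrightarrow> F (l i) = F (r i)" and "u \<in> V" "v \<in> V"
  shows "F u = F v"
proof -
  have "(u, v) \<in> {(a, b). a \<in> V \<and> b \<in> V \<and> {a, b} \<in> endpoint_edges N l r}\<^sup>*"
    using assms unfolding graph_connected_def by blast
  then show ?thesis
  proof (induction rule: rtrancl_induct)
    case (step a b)
    then obtain i where "i \<in> {1..N}" "{a, b} = {l i, r i}"
      by (auto simp: endpoint_edges_def)
    then show ?case using step.IH assms(2)[of i] by (auto simp: doubleton_eq_iff)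
  qed simp
qed

text \<open>Without a zero in \<open>(a, b)\<close>, the polynomial has constant sign there, and the integrand would vanish
  almost everywhere.\<close>
lemma poly_root_if_weighted_integral_zero:
  fixes \<omega> :: "real \<Rightarrow> real"
  assumes "a < b" and pos: "\<And>t. t \<in> {a<..<b} \<Longrightarrow> \<omega> t > 0"
    and int: "set_integrable lborel {a..b} (\<lambda>t. poly p t * \<omega> t)"
    and zero: "(LINT t:{a..b}|lborel. poly p t * \<omega> t) = 0"
  shows "\<exists>t\<in>{a<..<b}. poly p t = 0"
proof (rule ccontr)
  assume no_root: "\<not> ?thesis"
  let ?\<sigma> = "sgn (poly p ((a + b) / 2))"
  have mid: "(a + b) / 2 \<in> {a<..<b}" using \<open>a < b\<close> by auto
  have sign: "?\<sigma> * poly p t > 0" if t: "t \<in> {a<..<b}" for t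
  proof (rule ccontr)
    assume "\<not> ?\<sigma> * poly p t > 0"
    have nz: "poly p t \<noteq> 0" "poly p ((a + b) / 2) \<noteq> 0" using no_root t mid by auto
    from \<open>\<not> ?\<sigma> * poly p t > 0\<close> have neg: "poly p ((a + b) / 2) * poly p t < 0"
      using nz by (cases "poly p ((a + b) / 2) > 0") (auto simp: sgn_if mult_less_0_iff)
    then have "t \<noteq> (a + b) / 2" by (metis not_square_less_zero)
    then consider "t < (a + b) / 2" | "(a + b) / 2 < t" by linarith
    then show False
    proof cases
      case 1
      with poly_IVT[of t "(a + b) / 2" p] neg obtain u
        where "t < u" "u < (a + b) / 2" "poly p u = 0" by (auto simp: mult.commute)
      then show False using no_root t mid by auto
    next
      case 2
      with poly_IVT[of "(a + b) / 2" t p] neg obtain u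
        where "(a + b) / 2 < u" "u < t" "poly p u = 0" by auto
      then show False using no_root t mid by auto
    qed
  qed
  define f where "f t = ?\<sigma> * (indicator {a..b} t *\<^sub>R (poly p t * \<omega> t))" for t
  have f_pos: "f t > 0" if "t \<in> {a<..<b}" for t
    using mult_pos_pos[OF sign[OF that] pos[OF that]] that by (simp add: f_def mult.assoc)
  \<comment> \<open>Nothing is known about the sign of \<open>\<omega>\<close> at the two endpoints, which form a null set.\<close>
  have "AE t in lborel. t \<noteq> a \<and> t \<noteq> b"
    using AE_lborel_singleton[of a] AE_lborel_singleton[of b] by eventually_elim simp
  then have nonneg: "AE t in lborel. 0 \<le> f t"
  proof eventually_elim
    case (elim t)
    show ?case
    proof (cases "t \<in> {a..b}")
      case True
      then show ?thesis using f_pos[of t] elim by auto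
    qed (simp add: f_def)
  qed
  have "integrable lborel f"
    using int unfolding f_def set_integrable_def by (rule integrable_mult_right)
  moreover have "integral\<^sup>L lborel f = 0"
    using zero unfolding f_def set_lebesgue_integral_def by simp
  ultimately have "AE t in lborel. f t = 0"
    using integral_nonneg_eq_0_iff_AE nonneg by blast
  then have "AE t in lborel. t \<notin> {a<..<b}"
    by eventually_elim (use f_pos in force)
  then have "emeasure lborel {a<..<b} = 0"
    by (subst (asm) AE_iff_measurable[of "{a<..<b}"]) auto
  then show False using \<open>a < b\<close> by simp
qed

lemma zero_if_roots_in_gaps:
  fixes p :: "real poly" and x :: "nat \<Rightarrow> real"
  assumes mono: "\<And>i j. i \<le> j \<Longrightarrow> j \<le> N \<Longrightarrow> x i \<le> x j"
    and roots: "\<And>j. j < N \<Longrightarrow> \<exists>t\<in>{x j<..<x (Suc j)}. poly p t = 0"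
    and deg: "degree p < N"
  shows "p = 0"
proof (rule ccontr)
  assume "p \<noteq> 0"
  have "\<forall>j\<in>{..<N}. \<exists>t. t \<in> {x j<..<x (Suc j)} \<and> poly p t = 0" using roots by blast
  then obtain \<xi> where \<xi>: "\<And>j. j < N \<Longrightarrow> x j < \<xi> j \<and> \<xi> j < x (Suc j) \<and> poly p (\<xi> j) = 0"
    unfolding bchoice_iff by auto
  have less: "\<xi> i < \<xi> j" if "i < j" "j < N" for i j
  proof -
    have "\<xi> i < x (Suc i)" using \<xi> that by auto
    also have "\<dots> \<le> x j" using that by (intro mono) auto
    also have "\<dots> < \<xi> j" using \<xi> that by auto
    finally show ?thesis .
  qed
  have "inj_on \<xi> {..<N}"
    by (rule linorder_inj_onI) (use less in force)+
  then have "N = card (\<xi> ` {..<N})" by (simp add: card_image)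
  also have "\<dots> \<le> card {t. poly p t = 0}"
    using \<xi> poly_roots_finite[OF \<open>p \<noteq> 0\<close>] by (intro card_mono) auto
  also have "\<dots> \<le> degree p" using \<open>p \<noteq> 0\<close> by (rule card_poly_roots_bound)
  finally show False using deg by simp
qed

text \<open>The number of gaps equals the dimension of the space of polynomials of degree less than \<open>N\<close>.
  Connectedness is what allows the \<open>N\<close> given moments to determine the integrals over all gaps,
  since each is a difference of two values of the primitive \<open>F\<close>.\<close>
lemma zero_if_moments_zero:
  fixes x :: "nat \<Rightarrow> real"
  assumes "x 0 = -1" "x N = 1" and x_less: "\<And>i. i < N \<Longrightarrow> x i < x (Suc i)"
    and lr: "\<And>i. i \<in> {1..N} \<Longrightarrow> l i < r i \<and> r i \<le> N"
    and connected: "graph_connected {0..N} (endpoint_edges N l r)"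
    and par: "\<alpha> > -1" "\<beta> > -1" "\<zeta> \<in> {-1, 1}"
    and deg: "degree p < N"
    and moments: "\<And>i. i \<in> {1..N} \<Longrightarrow> moment \<alpha> \<beta> \<zeta> {x (l i)..x (r i)} p = 0"
  shows "p = 0"
proof (rule zero_if_roots_in_gaps[where x = x, OF _ _ deg])
  show mono: "x i \<le> x j" if "i \<le> j" "j \<le> N" for i j
    using that
  proof (induction rule: dec_induct)
    case (step m)
    then show ?case using x_less[of m] by simp
  qed simp
  have range: "x j \<in> {-1..1}" if "j \<le> N" for j
    using mono[of 0 j] mono[of j N] that assms(1,2) by simp
  let ?f = "\<lambda>t. poly p t * jacobi_weight \<alpha> \<beta> \<zeta> t"
  define F where "F j = integral {-1..x j} ?f" for j
  have int: "set_integrable lborel {a..b} ?f" if "a \<ge> -1" "b \<le> 1" for a b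
    using that by (intro jacobi_weight_integrable par) auto
  have diff: "moment \<alpha> \<beta> \<zeta> {x i..x j} p = F j - F i" if "i \<le> j" "j \<le> N" for i j
  proof -
    have "moment \<alpha> \<beta> \<zeta> {x i..x j} p = integral {x i..x j} ?f"
      using range[of i] range[of j] that unfolding moment_def
      by (intro set_borel_integral_eq_integral int) auto
    moreover have "F i + integral {x i..x j} ?f = F j"
      using range[of i] range[of j] mono[OF that] that unfolding F_def
      by (intro Henstock_Kurzweil_Integration.integral_combine
          set_borel_integral_eq_integral(1) int) auto
    ultimately show ?thesis by simp
  qed
  have "F (l i) = F (r i)" if "i \<in> {1..N}" for i
    using diff[of "l i" "r i"] lr[OF that] moments[OF that] by simp
  then have F_const: "F u = F v" if "u \<le> N" "v \<le> N" for u v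
    using constant_if_equal_on_edges[OF connected, of F u v] that by auto
  show "\<exists>t\<in>{x j<..<x (Suc j)}. poly p t = 0" if j: "j < N" for j
  proof (rule poly_root_if_weighted_integral_zero[OF x_less[OF j]])
    show "jacobi_weight \<alpha> \<beta> \<zeta> t > 0" if "t \<in> {x j<..<x (Suc j)}" for t
      using that range[of j] range[of "Suc j"] j by (intro jacobi_weight_pos par) auto
    show "set_integrable lborel {x j..x (Suc j)} ?f"
      using range[of j] range[of "Suc j"] j by (intro int) auto
    show "(LINT t:{x j..x (Suc j)}|lborel. ?f t) = 0"
      using diff[of j "Suc j"] F_const[of j "Suc j"] j by (simp add: moment_def)
  qed
qed

section \<open>The moment form\<close>

lemma moment_form_diag:
  "moment_form N \<alpha> \<beta> \<zeta> s (mat_diag N d) p q =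
     (\<Sum>i<N. d i * moment \<alpha> \<beta> \<zeta> (s (Suc i)) p * moment \<alpha> \<beta> \<zeta> (s (Suc i)) q)"
proof -
  have "row (mat_diag N d) i = d i \<cdot>\<^sub>v unit_vec N i" if "i < N" for i
    using that by (intro eq_vecI) (auto simp: mat_diag_def unit_vec_def)
  then have "(mat_diag N d *\<^sub>v moment_vec N \<alpha> \<beta> \<zeta> s q) $ i = d i * moment \<alpha> \<beta> \<zeta> (s (Suc i)) q"
    if "i < N" for i
    using that by (simp add: moment_vec_def mat_diag_def)
  moreover have "dim_vec (mat_diag N d *\<^sub>v moment_vec N \<alpha> \<beta> \<zeta> s q) = N"
    by (simp add: mat_diag_def)
  ultimately show ?thesis
    by (auto simp: moment_form_def scalar_prod_def lessThan_atLeast0 mult_ac moment_vec_def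
        intro!: sum.cong)
qed

text \<open>The columns of the moment matrix are the moment vectors, so the product is the Gram matrix.\<close>
lemma moment_matrix_gram:
  assumes "W \<in> carrier_mat N N"
  shows "(moment_matrix N \<alpha> \<beta> \<zeta> s \<Phi>)\<^sup>T * W * moment_matrix N \<alpha> \<beta> \<zeta> s \<Phi> =
           mat N N (\<lambda>(j, k). moment_form N \<alpha> \<beta> \<zeta> s W (\<Phi> j) (\<Phi> k))"
proof -
  let ?M = "moment_matrix N \<alpha> \<beta> \<zeta> s \<Phi>"
  have M: "?M \<in> carrier_mat N N" by (simp add: moment_matrix_def)
  have col: "col ?M k = moment_vec N \<alpha> \<beta> \<zeta> s (\<Phi> k)" if "k < N" for k
    using that by (intro eq_vecI) (auto simp: moment_matrix_def moment_vec_def)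
  have "?M\<^sup>T * W * ?M = ?M\<^sup>T * (W * ?M)"
    using M assms by (intro assoc_mult_mat[of _ N N _ N _ N]) auto
  also have "\<dots> = mat N N (\<lambda>(j, k). moment_form N \<alpha> \<beta> \<zeta> s W (\<Phi> j) (\<Phi> k))"
  proof (rule eq_matI)
    fix j k assume "j < dim_row (mat N N (\<lambda>(j, k). moment_form N \<alpha> \<beta> \<zeta> s W (\<Phi> j) (\<Phi> k)))"
      "k < dim_col (mat N N (\<lambda>(j, k). moment_form N \<alpha> \<beta> \<zeta> s W (\<Phi> j) (\<Phi> k)))"
    then have jk: "j < N" "k < N" by auto
    have "(?M\<^sup>T * (W * ?M)) $$ (j, k) = row ?M\<^sup>T j \<bullet> col (W * ?M) k"
      using jk M assms by (intro index_mult_mat) auto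
    also have "\<dots> = col ?M j \<bullet> (W *\<^sub>v col ?M k)"
      using jk M assms by (simp add: col_mult2[OF assms M])
    finally show "(?M\<^sup>T * (W * ?M)) $$ (j, k) =
        mat N N (\<lambda>(j, k). moment_form N \<alpha> \<beta> \<zeta> s W (\<Phi> j) (\<Phi> k)) $$ (j, k)"
      using jk by (simp add: col moment_form_def)
  qed (use M assms in auto)
  finally show ?thesis .
qed

lemma orthogonal_family_iff_gram_diag:
  assumes "W \<in> carrier_mat N N"
  shows "orthogonal_family N (moment_form N \<alpha> \<beta> \<zeta> s W) \<Phi> h \<longleftrightarrow>
    (moment_matrix N \<alpha> \<beta> \<zeta> s \<Phi>)\<^sup>T * W * moment_matrix N \<alpha> \<beta> \<zeta> s \<Phi> = mat_diag N h \<and>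
    (\<forall>k<N. h k > 0)"
proof -
  have "mat N N (\<lambda>(j, k). B (\<Phi> j) (\<Phi> k)) = mat_diag N h \<longleftrightarrow>
          (\<forall>j<N. \<forall>k<N. B (\<Phi> j) (\<Phi> k) = (if j = k then h k else 0))"
    for B :: "real poly \<Rightarrow> real poly \<Rightarrow> real"
    unfolding mat_diag_def mat_eq_iff by auto
  then show ?thesis
    unfolding moment_matrix_gram[OF assms] orthogonal_family_def by simp
qed

text \<open>The form is a weighted sum of squares of moments, so it is definite precisely because the
  moment map has trivial kernel.\<close>
lemma positive_poly_form_moment_form:
  assumes par: "\<alpha> > -1" "\<beta> > -1"
    and s: "\<And>i. i < N \<Longrightarrow> s (Suc i) \<in> sets lborel \<and> s (Suc i) \<subseteq> {-1..1}"
    and d: "\<And>i. i < N \<Longrightarrow> d i > 0"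
    and inj: "\<And>p. degree p < N \<Longrightarrow> (\<And>i. i < N \<Longrightarrow> moment \<alpha> \<beta> \<zeta> (s (Suc i)) p = 0) \<Longrightarrow> p = 0"
  shows "positive_poly_form (moment_form N \<alpha> \<beta> \<zeta> s (mat_diag N d)) N"
proof
  let ?B = "moment_form N \<alpha> \<beta> \<zeta> s (mat_diag N d)"
  fix p q u :: "real poly" and c :: real
  show "?B p q = ?B q p" by (simp add: moment_form_diag mult_ac)
  have "moment \<alpha> \<beta> \<zeta> (s (Suc i)) (p + q) =
      moment \<alpha> \<beta> \<zeta> (s (Suc i)) p + moment \<alpha> \<beta> \<zeta> (s (Suc i)) q" if "i < N" for i
    using s[OF that] by (intro moment_add par) auto
  then show "?B (p + q) u = ?B p u + ?B q u"
    by (auto simp: moment_form_diag algebra_simps sum.distrib[symmetric] intro!: sum.cong)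
  show "?B (Polynomial.smult c p) u = c * ?B p u"
    by (simp add: moment_form_diag moment_smult sum_distrib_left mult_ac)
  show "0 < ?B p p" if p: "p \<noteq> 0" "degree p < N"
  proof -
    obtain i where i: "i < N" "moment \<alpha> \<beta> \<zeta> (s (Suc i)) p \<noteq> 0" using inj[OF p(2)] p(1) by blast
    have "0 < (\<Sum>i<N. d i * (moment \<alpha> \<beta> \<zeta> (s (Suc i)) p)\<^sup>2)"
      using i d by (intro sum_pos2[of _ i]) (auto simp: less_imp_le)
    then show ?thesis by (simp add: moment_form_diag power2_eq_square mult.assoc)
  qed
qed

theorem mainTheorem13:
  fixes N :: nat and x :: "nat \<Rightarrow> real" and l r :: "nat \<Rightarrow> nat"
    and s :: "nat \<Rightarrow> real set" and \<alpha> \<beta> \<zeta> :: real and w :: "nat \<Rightarrow> real" and W :: "real mat"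
  assumes "N \<ge> 2"
    and "x 0 = -1" and "x N = 1" and "\<And>i. i < N \<Longrightarrow> x i < x (Suc i)"
    and "\<And>i. i \<in> {1..N} \<Longrightarrow> l i < r i \<and> r i \<le> N"
    and "\<And>i. i \<in> {1..N} \<Longrightarrow> s i = {x (l i)..x (r i)}"
    and "graph_connected {0..N} (endpoint_edges N l r)"
    and "\<alpha> > -1" and "\<beta> > -1" and "\<zeta> \<in> {-1, 1}"
    and "\<And>i. i \<in> {1..N} \<Longrightarrow> w i > 0"
    and "W = mat_diag N (\<lambda>i. w (Suc i))"
  shows "(\<exists>!\<Phi>. \<Phi> \<in> monic_families N \<and>
            (\<exists>h. orthogonal_family N (moment_form N \<alpha> \<beta> \<zeta> s W) \<Phi> h)) \<and>
         (\<forall>\<Phi>\<in>monic_families N. \<forall>h.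
            orthogonal_family N (moment_form N \<alpha> \<beta> \<zeta> s W) \<Phi> h \<longleftrightarrow>
            (moment_matrix N \<alpha> \<beta> \<zeta> s \<Phi>)\<^sup>T * W * moment_matrix N \<alpha> \<beta> \<zeta> s \<Phi> = mat_diag N h \<and>
            (\<forall>k<N. h k > 0))"
proof
  have x_mono: "x i \<le> x j" if "i \<le> j" "j \<le> N" for i j
    using that
  proof (induction rule: dec_induct)
    case (step m)
    then show ?case using assms(4)[of m] by simp
  qed simp
  have "s (Suc i) \<in> sets lborel \<and> s (Suc i) \<subseteq> {-1..1}" if "i < N" for i
    using assms(5)[of "Suc i"] assms(6)[of "Suc i"] x_mono[of 0 "l (Suc i)"]
      x_mono[of "r (Suc i)" N] that assms(2,3) by auto
  moreover have "p = 0"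
    if deg: "degree p < N" and zero: "\<And>i. i < N \<Longrightarrow> moment \<alpha> \<beta> \<zeta> (s (Suc i)) p = 0" for p
  proof (rule zero_if_moments_zero[OF assms(2-5,7-10) deg])
    fix i assume i: "i \<in> {1..N}"
    then have "i - 1 < N" "Suc (i - 1) = i" by auto
    then show "moment \<alpha> \<beta> \<zeta> {x (l i)..x (r i)} p = 0"
      using zero[of "i - 1"] assms(6)[OF i] by simp
  qed
  ultimately interpret positive_poly_form "moment_form N \<alpha> \<beta> \<zeta> s W" N
    unfolding assms(12) using assms(8,9,11) by (intro positive_poly_form_moment_form) auto
  show "\<exists>!\<Phi>. \<Phi> \<in> monic_families N \<and>
      (\<exists>h. orthogonal_family N (moment_form N \<alpha> \<beta> \<zeta> s W) \<Phi> h)"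
    by (rule ex1_monic_orthogonal_family)
  have "W \<in> carrier_mat N N" by (simp add: assms(12))
  then show "\<forall>\<Phi>\<in>monic_families N. \<forall>h.
      orthogonal_family N (moment_form N \<alpha> \<beta> \<zeta> s W) \<Phi> h \<longleftrightarrow>
      (moment_matrix N \<alpha> \<beta> \<zeta> s \<Phi>)\<^sup>T * W * moment_matrix N \<alpha> \<beta> \<zeta> s \<Phi> = mat_diag N h \<and>
      (\<forall>k<N. h k > 0)"
    by (intro ballI allI orthogonal_family_iff_gram_diag)
qed

end
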